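(* Let $m$ be an odd square-free positive integer and $p$ a prime with $\gcd(p,m)=1$; put $r=\mathrm{rem}(p,m)$ and $q=\mathrm{quo}(p,m)$. Then for all integers $i,j$ with $0\leq i\leq\varphi(m)-1$ and $0\leq j\leq q$, \[ f_{m,p,i,j}= \begin{cases} -\mathcal{R}_{ir}\left(\Psi_{m}\cdot\mathcal{E}_{r}\mathcal{T}_{i+1}\Phi_{m}\right) & 0\leq j\leq q-1,\\ \mathcal{T}_{r}f_{m,p,i,0} & j=q. \end{cases} \]
   Context: $\Phi_n$ is the $n$-th cyclotomic polynomial, $\varphi$ is Euler's totient function, and $\Psi_m(x)=(x^m-1)/\Phi_m(x)$ is the $m$-th inverse cyclotomic polynomial. For integers $a,b$ with $b>0$, $\mathrm{rem}(a,b)$ denotes the non-negative remainder and $\mathrm{quo}(a,b)$ the quotient; for polynomials, $\mathrm{rem}(f,g)$ denotes the polynomial remainder. Blocks: write (uniquely) $\Phi_{mp}(x)=\sum_{i\geq0}f_{m,p,i}(x)\,x^{ip}$ with $\deg f_{m,p,i}<p$, and $f_{m,p,i}(x)=\sum_{j\geq0}f_{m,p,i,j}(x)\,x^{jm}$ with $\deg f_{m,p,i,j}<m$. Operations on polynomials $f$ (with $s$ an integer): $\mathcal{T}_s f=\mathrm{rem}(f,x^s)$ ("truncate", $s\ge 0$); $\mathcal{R}_s f=\mathrm{rem}\left(x^{m-\mathrm{rem}(s,m)}f,\;x^m-1\right)$ ("rotate"); $\mathcal{E}_s f=f\left(x^{\mathrm{rem}(s,m)}\right)$ ("expand"). *)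

theory Defs
  imports Complex_Main
    "HOL-Computational_Algebra.Computational_Algebra"
    "HOL-Number_Theory.Totient"
begin

text \<open>
  All polynomials are taken over the complex numbers, where the roots of the cyclotomic
  polynomials live and polynomial division with remainder is available.  Every divisor below
  is monic, so quotients and remainders agree with those over the integers.
\<close>

definition cyclotomic :: "nat \<Rightarrow> complex poly" where
  "cyclotomic n = (\<Prod>k\<in>totatives n. [:- cis (2 * pi * real k / real n), 1:])"

definition inv_cyclotomic :: "nat \<Rightarrow> complex poly" where
  "inv_cyclotomic m = (monom 1 m - 1) div cyclotomic m"

text \<open>
  The family of coefficients of the expansion of \<open>f\<close> in powers of \<open>x ^ k\<close>:
  \<open>f = (\<Sum>i\<ge>0. blocks k f i * x ^ (i * k))\<close> with \<open>degree (blocks k f i) < k\<close>.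
  Existence and uniqueness for \<open>k > 0\<close> are proved below (\<open>is_blocks_iff\<close>).
\<close>

definition is_blocks :: "nat \<Rightarrow> complex poly \<Rightarrow> (nat \<Rightarrow> complex poly) \<Rightarrow> bool" where
  "is_blocks k f g \<longleftrightarrow>
     (\<forall>i. degree (g i) < k) \<and> finite {i. g i \<noteq> 0} \<and>
     f = (\<Sum>i\<in>{i. g i \<noteq> 0}. g i * monom 1 (i * k))"

definition blocks :: "nat \<Rightarrow> complex poly \<Rightarrow> nat \<Rightarrow> complex poly" where
  "blocks k f = (THE g. is_blocks k f g)"

definition cyc_block :: "nat \<Rightarrow> nat \<Rightarrow> nat \<Rightarrow> complex poly" where
  "cyc_block m p i = blocks p (cyclotomic (m * p)) i"

definition cyc_subblock :: "nat \<Rightarrow> nat \<Rightarrow> nat \<Rightarrow> nat \<Rightarrow> complex poly" where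
  "cyc_subblock m p i j = blocks m (cyc_block m p i) j"

definition ptruncate :: "nat \<Rightarrow> complex poly \<Rightarrow> complex poly" where
  "ptruncate s f = f mod monom 1 s"

definition protate :: "nat \<Rightarrow> int \<Rightarrow> complex poly \<Rightarrow> complex poly" where
  "protate m s f = (monom 1 (m - nat (s mod int m)) * f) mod (monom 1 m - 1)"

definition pexpand :: "nat \<Rightarrow> int \<Rightarrow> complex poly \<Rightarrow> complex poly" where
  "pexpand m s f = pcompose f (monom 1 (nat (s mod int m)))"

lemma is_blocks_coeff:
  assumes g: "is_blocks k f g"
  shows "coeff (g i) j = (if j < k then coeff f (i * k + j) else 0)"
proof (cases "j < k")
  case False
  have "degree (g i) < k" using g by (simp add: is_blocks_def)
  with False show ?thesis by (simp add: coeff_eq_0)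
next
  case True
  let ?S = "{i. g i \<noteq> 0}"
  have fin: "finite ?S" and deg: "\<And>i. degree (g i) < k"
    and f: "f = (\<Sum>i\<in>?S. g i * monom 1 (i * k))"
    using g by (auto simp: is_blocks_def)
  have trm: "coeff (g l * monom 1 (l * k)) (i * k + j) = (if l = i then coeff (g i) j else 0)" for l
  proof -
    consider "l = i" | "l < i" | "l > i" by linarith
    then show ?thesis
    proof cases
      case 1
      then show ?thesis by (simp add: mult.commute[of _ "monom _ _"] coeff_monom_mult)
    next
      case 2
      then have "Suc l * k \<le> i * k" by (intro mult_le_mono1) simp
      then have le: "l * k + k \<le> i * k" by simp
      then have "degree (g l) < i * k + j - l * k" using deg[of l] by linarith
      with 2 le show ?thesis
        by (simp add: mult.commute[of _ "monom _ _"] coeff_monom_mult coeff_eq_0)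
    next
      case 3
      then have "Suc i * k \<le> l * k" by (intro mult_le_mono1) simp
      then have "i * k + j < l * k" using True by simp
      with 3 show ?thesis
        by (simp add: mult.commute[of _ "monom _ _"] coeff_monom_mult)
    qed
  qed
  have "coeff f (i * k + j) = (\<Sum>l\<in>?S. if l = i then coeff (g i) j else 0)"
    by (subst f) (simp add: coeff_sum trm)
  also have "\<dots> = coeff (g i) j" using fin by simp
  finally show ?thesis using True by simp
qed

lemma is_blocks_exists:
  assumes k: "k > 0"
  shows "is_blocks k f (\<lambda>i. poly_cutoff k (poly_shift (i * k) f))"
proof -
  define g where "g = (\<lambda>i. poly_cutoff k (poly_shift (i * k) f))"
  have cg: "coeff (g i) j = (if j < k then coeff f (i * k + j) else 0)" for i j
    by (simp add: g_def coeff_poly_cutoff coeff_poly_shift add.commute)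
  have deg: "degree (g i) < k" for i
  proof -
    have "degree (g i) \<le> k - 1" using k by (intro degree_le) (auto simp: cg)
    then show ?thesis using k by linarith
  qed
  have "g i = 0" if "i > degree f" for i
  proof (rule poly_eqI)
    fix j
    have "degree f < i * k" using that k by (metis less_le_trans mult.right_neutral mult_le_mono2 Suc_leI One_nat_def)
    then show "coeff (g i) j = coeff 0 j" by (simp add: cg coeff_eq_0)
  qed
  then have sub: "{i. g i \<noteq> 0} \<subseteq> {..degree f}" by (force simp: not_less[symmetric])
  then have fin: "finite {i. g i \<noteq> 0}" by (rule finite_subset) simp
  define h where "h = (\<Sum>i\<in>{i. g i \<noteq> 0}. g i * monom 1 (i * k))"
  have "is_blocks k h g" using deg fin by (simp add: is_blocks_def h_def)
  note ch = is_blocks_coeff[OF this]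
  have "f = h"
  proof (rule poly_eqI)
    fix n
    show "coeff f n = coeff h n"
      using ch[of "n div k" "n mod k"] cg[of "n div k" "n mod k"] k by simp
  qed
  with \<open>is_blocks k h g\<close> show ?thesis unfolding g_def[symmetric] by simp
qed

lemma is_blocks_iff:
  assumes "k > 0"
  shows "is_blocks k f g \<longleftrightarrow> g = blocks k f"
proof -
  have ex: "\<exists>!g. is_blocks k f g"
  proof (rule ex_ex1I)
    show "\<exists>g. is_blocks k f g" using is_blocks_exists[OF assms] by blast
  next
    fix g h assume "is_blocks k f g" "is_blocks k f h"
    then show "g = h" by (intro ext poly_eqI) (simp add: is_blocks_coeff)
  qed
  then show ?thesis unfolding blocks_def by (metis the1_equality theI')
qed

end

theory Submission
  imports Defs
begin

text \<open>
  From \<open>\<Phi>\<^sub>m\<^sub>p(x) \<Phi>\<^sub>m(x) = \<Phi>\<^sub>m(x\<^sup>p)\<close> one gets \<open>\<Phi>\<^sub>m\<^sub>p(x) (x\<^sup>m - 1) = \<Phi>\<^sub>m(x\<^sup>p) \<Psi>\<^sub>m(x)\<close>.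
  Dividing by \<open>x\<^sup>m - 1\<close> as power series, and using \<open>deg \<Psi>\<^sub>m < m\<close>, the coefficient of \<open>x\<^sup>n\<close> in
  \<open>\<Phi>\<^sub>m\<^sub>p\<close> is \<open>-\<Sum> a\<^sub>s b\<^sub>t\<close>, where \<open>a\<close> and \<open>b\<close> are the coefficients of \<open>\<Phi>\<^sub>m\<close> and \<open>\<Psi>\<^sub>m\<close>, the sum runs
  over \<open>s \<le> n div p\<close>, and \<open>t = (n - s p) mod m\<close>. For \<open>n = i p + j m + k\<close> inside the \<open>i\<close>-th block this
  does not depend on \<open>j\<close>, and it is the \<open>k\<close>-th coefficient of the rotated product.
\<close>

section \<open>Roots of unity\<close>

lemma cis_2pi_div_cong:
  assumes "n > 0" and "[a = b] (mod n)"
  shows "cis (2 * pi * real a / real n) = cis (2 * pi * real b / real n)"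
proof -
  have red: "cis (2 * pi * real c / real n) = cis (2 * pi * real (c mod n) / real n)" for c
  proof -
    have "real c = real (n * (c div n) + c mod n)" by simp
    then have "2 * pi * real c / real n
        = 2 * pi * real (c div n) + 2 * pi * real (c mod n) / real n"
      using assms(1) unfolding of_nat_add of_nat_mult by (simp add: field_simps)
    then show ?thesis by (simp flip: cis_mult)
  qed
  show ?thesis using red[of a] red[of b] assms(2) by (simp add: cong_def)
qed

text \<open>The range \<open>{0<..n}\<close> is chosen because it contains
  \<open>totatives n\<close>, even for \<open>n = 1\<close>; reduction mod \<open>n\<close> leads
  back to the range \<open>{..<n}\<close> of \<open>bij_betw_roots_unity\<close>.\<close>

lemma inj_on_cis_2pi_div: "inj_on (\<lambda>k. cis (2 * pi * real k / real n)) {0<..n}"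
proof (rule inj_onI)
  fix a b
  assume ab: "a \<in> {0<..n}" "b \<in> {0<..n}"
    and eq: "cis (2 * pi * real a / real n) = cis (2 * pi * real b / real n)"
  have n: "n > 0" using ab by auto
  have "cis (2 * pi * real (a mod n) / real n) = cis (2 * pi * real (b mod n) / real n)"
    using eq cis_2pi_div_cong[OF n, of "a mod n" a] cis_2pi_div_cong[OF n, of "b mod n" b]
    by simp
  moreover have "a mod n \<in> {..<n}" "b mod n \<in> {..<n}" using n by auto
  ultimately have "a mod n = b mod n"
    using bij_betw_imp_inj_on[OF bij_betw_roots_unity[OF n]] by (meson inj_onD)
  \<comment> \<open>Reduction mod \<open>n\<close> fixes every index of the range except
    \<open>n\<close>, which goes to 0.\<close>
  then show "a = b"
    using ab by (cases "a = n"; cases "b = n") auto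
qed

section \<open>Cyclotomic polynomials and their inverses\<close>

lemma lead_coeff_cyclotomic: "lead_coeff (cyclotomic n) = 1"
  by (simp add: cyclotomic_def lead_coeff_prod)

lemma degree_cyclotomic: "degree (cyclotomic n) = totient n"
  unfolding cyclotomic_def by (subst degree_prod_sum_eq) (auto simp: totient_def)

lemma cyclotomic_nonzero: "cyclotomic n \<noteq> 0"
  using lead_coeff_cyclotomic[of n] by auto

text \<open>Here \<open>k\<close> need not be a totative: at level \<open>m\<close> the lemma is
  applied to indices \<open>k\<close> up to \<open>m * p\<close>.\<close>

lemma poly_cyclotomic_root:
  assumes "n > 0" and "coprime k n"
  shows "poly (cyclotomic n) (cis (2 * pi * real k / real n)) = 0"
proof -
  \<comment> \<open>The only totative of 1 is 1, whereas \<open>k mod 1\<close> is 0.\<close>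
  define l where "l = (if n = 1 then 1 else k mod n)"
  have "l > 0"
  proof (cases "n = 1")
    case False
    have "k mod n \<noteq> 0"
    proof
      assume "k mod n = 0"
      then have "n dvd k" by auto
      with assms(2) have "is_unit n" by (meson coprime_common_divisor dvd_refl)
      with False show False by simp
    qed
    with False show ?thesis by (simp add: l_def)
  qed (simp add: l_def)
  moreover have "l \<le> n" using assms(1) by (auto simp: l_def)
  moreover have "coprime l n" using assms by (auto simp: l_def)
  ultimately have "l \<in> totatives n" by (simp add: in_totatives_iff)
  moreover have "[k = l] (mod n)" by (auto simp: l_def cong_def)
  then have "cis (2 * pi * real k / real n) = cis (2 * pi * real l / real n)"
    using assms(1) by (rule cis_2pi_div_cong[rotated])
  ultimately show ?thesis
    by (auto simp: cyclotomic_def poly_prod)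
qed

lemma degree_monom_minus_1:
  assumes "m > 0"
  shows "degree (monom 1 m - 1 :: 'a :: comm_ring_1 poly) = m"
  using assms by (intro antisym degree_le le_degree) (auto simp: coeff_1)

text \<open>Two monic polynomials of degree \<open>m\<close> that agree at \<open>m\<close> distinct
  points, here the \<open>m\<close>-th roots of unity, are equal.\<close>

lemma monom_minus_1_eq_prod:
  assumes "m > 0"
  shows "monom 1 m - 1 = (\<Prod>k\<in>{0<..m}. [:- cis (2 * pi * real k / real m), 1:])"
proof (rule poly_eqI_degree_lead_coeff)
  let ?z = "\<lambda>k. cis (2 * pi * real k / real m)"
  let ?P = "\<Prod>k\<in>{0<..m}. [:- ?z k, 1:]"
  have deg: "degree ?P = m" by (subst degree_prod_sum_eq) auto
  then show "degree ?P \<le> m" by simp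
  show "degree (monom 1 m - 1 :: complex poly) \<le> m"
    using assms by (simp add: degree_monom_minus_1)
  have "lead_coeff ?P = 1" by (simp add: lead_coeff_prod)
  then show "coeff (monom 1 m - 1) m = coeff ?P m"
    using assms by (simp add: deg coeff_1)
  show "m \<le> card (?z ` {0<..m})"
    by (simp add: card_image inj_on_cis_2pi_div)
  show "poly (monom 1 m - 1) x = poly ?P x" if x: "x \<in> ?z ` {0<..m}" for x
  proof -
    from x obtain k where k: "k \<in> {0<..m}" "x = ?z k" by auto
    have "x ^ m = cis (2 * pi * real k)" using assms k by (simp add: DeMoivre)
    then have "x ^ m = 1" by simp
    moreover have "poly ?P x = 0" using k by (auto simp: poly_prod)
    ultimately show ?thesis by (simp add: poly_monom)
  qed
qed

lemma cyclotomic_dvd_monom_minus_1: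
  assumes "m > 0"
  shows "cyclotomic m dvd monom 1 m - 1"
  unfolding monom_minus_1_eq_prod[OF assms] cyclotomic_def
  by (rule prod_dvd_prod_subset) (auto simp: totatives_def)

lemma cyclotomic_mult_inv_cyclotomic:
  assumes "m > 0"
  shows "cyclotomic m * inv_cyclotomic m = monom 1 m - 1"
  using cyclotomic_dvd_monom_minus_1[OF assms] by (simp add: inv_cyclotomic_def)

text \<open>The degree is \<open>m - totient m\<close>. The strict bound ensures that division by 1
  - x^m repeats the coefficients with period \<open>m\<close> and without overlap.\<close>

lemma degree_inv_cyclotomic_less:
  assumes "m > 0"
  shows "degree (inv_cyclotomic m) < m"
proof -
  have ne: "monom 1 m - 1 \<noteq> (0 :: complex poly)"
    using degree_monom_minus_1[OF assms, where ?'a = complex] assms by auto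
  then have "inv_cyclotomic m \<noteq> 0"
    using cyclotomic_mult_inv_cyclotomic[OF assms] by auto
  then have "totient m + degree (inv_cyclotomic m) = m"
    using cyclotomic_mult_inv_cyclotomic[OF assms] degree_monom_minus_1[OF assms, where ?'a = complex]
    by (metis cyclotomic_nonzero degree_cyclotomic degree_mult_eq)
  moreover have "totient m > 0" using assms by simp
  ultimately show ?thesis by linarith
qed

text \<open>Both sides are monic of degree \<open>totient m * p\<close> and vanish at the distinct
  points indexed by \<open>?S\<close>, whose number is that degree. The two parts of
  \<open>?S\<close> are disjoint because \<open>p\<close> divides no totative of
  \<open>m * p\<close>. Every index in \<open>?S\<close> is coprime to \<open>m\<close>, so the
  \<open>p\<close>-th power of each point is a primitive \<open>m\<close>-th root of unity.\<close>

lemma cyclotomic_mult_prime: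
  assumes m: "m > 0" and p: "prime p" and cop: "coprime p m"
  shows "cyclotomic (m * p) * cyclotomic m = pcompose (cyclotomic m) (monom 1 p)"
proof (rule poly_eqI_degree_lead_coeff)
  let ?z = "\<lambda>k. cis (2 * pi * real k / real (m * p))"
  let ?S = "totatives (m * p) \<union> (*) p ` totatives m"
  have p0: "p > 0" using p by (simp add: prime_gt_0_nat)
  have tot: "totient (m * p) + totient m = totient m * p"
  proof -
    have "totient (m * p) = totient m * (p - 1)"
      using p cop by (simp add: totient_mult_coprime coprime_commute totient_prime)
    then show ?thesis using p0 by (simp add: algebra_simps)
  qed
  have degL: "degree (cyclotomic (m * p) * cyclotomic m) = totient m * p"
    by (simp add: degree_mult_eq cyclotomic_nonzero degree_cyclotomic tot)
  have degR: "degree (pcompose (cyclotomic m) (monom 1 p)) = totient m * p"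
    by (simp add: degree_pcompose degree_cyclotomic degree_monom_eq)
  show "degree (cyclotomic (m * p) * cyclotomic m) \<le> totient m * p"
    "degree (pcompose (cyclotomic m) (monom 1 p)) \<le> totient m * p"
    using degL degR by auto
  have "lead_coeff (cyclotomic (m * p) * cyclotomic m) = 1"
    unfolding lead_coeff_mult lead_coeff_cyclotomic by simp
  moreover have "lead_coeff (pcompose (cyclotomic m) (monom 1 p)) = 1"
    using p0 by (subst lead_coeff_comp) (auto simp: degree_monom_eq lead_coeff_cyclotomic)
  ultimately show "coeff (cyclotomic (m * p) * cyclotomic m) (totient m * p)
      = coeff (pcompose (cyclotomic m) (monom 1 p)) (totient m * p)"
    unfolding degL degR by simp
  have sub: "?S \<subseteq> {0<..m * p}" using p0 by (auto simp: in_totatives_iff)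
  have "card ?S = card (totatives (m * p)) + card ((*) p ` totatives m)"
  proof (rule card_Un_disjoint)
    show "totatives (m * p) \<inter> (*) p ` totatives m = {}"
      using p by (auto simp: in_totatives_iff)
  qed auto
  also have "\<dots> = totient m * p"
    using p0 by (subst card_image) (auto simp: inj_on_def totient_def tot[unfolded totient_def])
  finally have "card (?z ` ?S) = totient m * p"
    using inj_on_subset[OF inj_on_cis_2pi_div sub] by (simp only: card_image)
  then show "totient m * p \<le> card (?z ` ?S)" by simp
  show "poly (cyclotomic (m * p) * cyclotomic m) x = poly (pcompose (cyclotomic m) (monom 1 p)) x"
    if x: "x \<in> ?z ` ?S" for x
  proof -
    from x obtain k where k: "k \<in> ?S" "x = ?z k" by auto
    have "coprime k m" using k cop by (auto simp: in_totatives_iff)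
    moreover have "x ^ p = cis (2 * pi * real k / real m)"
      using p0 k by (simp add: DeMoivre)
    ultimately have "poly (pcompose (cyclotomic m) (monom 1 p)) x = 0"
      using m by (simp add: poly_pcompose poly_monom poly_cyclotomic_root)
    moreover have "poly (cyclotomic (m * p) * cyclotomic m) x = 0"
    proof (cases "k \<in> totatives (m * p)")
      case True
      then have "poly (cyclotomic (m * p)) x = 0"
        using k m p0 poly_cyclotomic_root[of "m * p" k] by (simp add: in_totatives_iff)
      then show ?thesis by simp
    next
      case False
      with k obtain l where l: "l \<in> totatives m" "k = p * l" by auto
      have "x = cis (2 * pi * real l / real m)" using k l p0 by (simp add: mult.assoc)
      then have "poly (cyclotomic m) x = 0"
        using l m by (simp add: poly_cyclotomic_root in_totatives_iff)
      then show ?thesis by simp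
    qed
    ultimately show ?thesis by simp
  qed
qed

lemma cyclotomic_mult_prime_mult_monom_minus_1:
  assumes "m > 0" and "prime p" and "coprime p m"
  shows "cyclotomic (m * p) * (monom 1 m - 1)
    = pcompose (cyclotomic m) (monom 1 p) * inv_cyclotomic m"
  using cyclotomic_mult_inv_cyclotomic[OF assms(1)] cyclotomic_mult_prime[OF assms]
  by (metis mult.assoc)

section \<open>Coefficients of the cyclotomic polynomial of order \<open>m * p\<close>\<close>

lemma pcompose_monom_monom:
  "pcompose (monom c s) (monom 1 e) = (monom c (s * e) :: 'a :: comm_semiring_1 poly)"
  by (induction s) (auto simp: monom_Suc pcompose_pCons mult_monom monom_0)

lemma pcompose_monom_eq_sum:
  fixes f :: "'a :: comm_semiring_1 poly"
  assumes "degree f \<le> n"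
  shows "pcompose f (monom 1 e) = (\<Sum>s\<le>n. monom (coeff f s) (s * e))"
proof -
  have "pcompose f (monom 1 e) = pcompose (\<Sum>s\<le>n. monom (coeff f s) s) (monom 1 e)"
    using assms by (simp add: poly_as_sum_of_monoms')
  then show ?thesis by (simp add: pcompose_sum pcompose_monom_monom)
qed

lemma coeff_cyclotomic_mult_prime:
  assumes m: "m > 0" and p: "prime p" and cop: "coprime p m"
  shows "coeff (cyclotomic (m * p)) n = - (\<Sum>s\<le>n div p.
    coeff (cyclotomic m) s * coeff (inv_cyclotomic m) ((n - s * p) mod m))"
proof -
  define a where "a = coeff (cyclotomic m)"
  define b where "b = coeff (inv_cyclotomic m)"
  define c where "c = coeff (cyclotomic (m * p))"
  \<comment> \<open>One bound for the whole induction: it covers the degree of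
    \<open>cyclotomic m\<close> and also the final range \<open>n div p\<close>.\<close>
  define N where "N = totient m + n div p"
  \<comment> \<open>\<open>g n s\<close> is the coefficient of x^n in the power series of x^(sp)
    \<open>inv_cyclotomic m\<close> / (1 - x^m).\<close>
  define g where "g = (\<lambda>n s. if s * p \<le> n then b ((n - s * p) mod m) else 0)"
  have b0: "b t = 0" if "t \<ge> m" for t
    using that degree_inv_cyclotomic_less[OF m] by (simp add: b_def coeff_eq_0)
  \<comment> \<open>Comparing coefficients in the product with x^m - 1 gives a recurrence from
    \<open>n - m\<close> to \<open>n\<close>.\<close>
  have step: "(if m \<le> n then c (n - m) else 0) - c n
      = (\<Sum>s\<le>N. a s * (if s * p \<le> n then b (n - s * p) else 0))" for n
  proof -
    have "coeff (cyclotomic (m * p) * (monom 1 m - 1)) n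
        = coeff (monom 1 m * cyclotomic (m * p) - cyclotomic (m * p)) n"
      by (simp add: algebra_simps)
    also have "\<dots> = (if m \<le> n then c (n - m) else 0) - c n"
      by (simp add: coeff_monom_mult c_def)
    finally have L: "coeff (cyclotomic (m * p) * (monom 1 m - 1)) n
        = (if m \<le> n then c (n - m) else 0) - c n" .
    have "pcompose (cyclotomic m) (monom 1 p) = (\<Sum>s\<le>N. monom (a s) (s * p))"
      unfolding a_def by (rule pcompose_monom_eq_sum) (simp add: degree_cyclotomic N_def)
    then have "coeff (pcompose (cyclotomic m) (monom 1 p) * inv_cyclotomic m) n
        = (\<Sum>s\<le>N. coeff (monom (a s) (s * p) * inv_cyclotomic m) n)"
      by (simp add: sum_distrib_right coeff_sum)
    also have "\<dots> = (\<Sum>s\<le>N. a s * (if s * p \<le> n then b (n - s * p) else 0))"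
      by (intro sum.cong) (auto simp: coeff_monom_mult b_def)
    finally show ?thesis
      using L cyclotomic_mult_prime_mult_monom_minus_1[OF assms] by simp
  qed
  have "c n = - (\<Sum>s\<le>N. a s * g n s)" for n
  proof (induction n rule: less_induct)
    case (less n)
    show ?case
    proof (cases "m \<le> n")
      case False
      have "g n s = (if s * p \<le> n then b (n - s * p) else 0)" for s
        using False by (simp add: g_def)
      then show ?thesis using step[of n] False by (simp flip: step)
    next
      case True
      \<comment> \<open>At most one summand is nonzero: if \<open>s * p \<le> n - m\<close>, then
        \<open>n - s * p \<ge> m\<close> and \<open>b\<close> vanishes there; otherwise
        \<open>g (n - m) s\<close> is 0.\<close>
      have "g n s = g (n - m) s + (if s * p \<le> n then b (n - s * p) else 0)" for s
      proof (cases "s * p \<le> n - m")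
        case t: True
        have "n - s * p = (n - m - s * p) + m" using t True by simp
        then have "(n - s * p) mod m = (n - m - s * p) mod m" by (metis mod_add_self2)
        then show ?thesis using t True b0[of "n - s * p"] by (simp add: g_def)
      next
        case f: False
        then have "n - s * p < m" using True m by linarith
        then show ?thesis using f by (simp add: g_def)
      qed
      then have "(\<Sum>s\<le>N. a s * g n s) = (\<Sum>s\<le>N. a s * g (n - m) s) + (c (n - m) - c n)"
        using step[of n] True by (simp add: ring_distribs sum.distrib)
      moreover have "c (n - m) = - (\<Sum>s\<le>N. a s * g (n - m) s)"
        using less True m by simp
      ultimately show ?thesis by simp
    qed
  qed
  also have "(\<Sum>s\<le>N. a s * g n s) = (\<Sum>s\<le>n div p. a s * g n s)"
    using prime_gt_0_nat[OF p]
    by (intro sum.mono_neutral_right) (auto simp: N_def g_def less_eq_div_iff_mult_less_eq)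
  also have "\<dots> = (\<Sum>s\<le>n div p. a s * b ((n - s * p) mod m))"
    using prime_gt_0_nat[OF p]
    by (intro sum.cong) (auto simp: g_def less_eq_div_iff_mult_less_eq)
  finally show ?thesis by (simp add: a_def b_def c_def)
qed

section \<open>Truncation, rotation and expansion on coefficients\<close>

lemma ptruncate_eq_poly_cutoff: "ptruncate s f = poly_cutoff s f"
\<comment> \<open>For \<open>s = 0\<close> the modulus is the constant 1, and no remainder has
  smaller degree in the sense of \<open>mod_poly_less\<close>.\<close>
proof (cases "s = 0")
  case True
  then show ?thesis by (simp add: ptruncate_def poly_eq_iff coeff_poly_cutoff)
next
  case False
  have "f = poly_shift s f * monom 1 s + poly_cutoff s f"
    by (rule poly_eqI)
      (simp add: mult.commute[of _ "monom _ _"] coeff_monom_mult coeff_poly_cutoff coeff_poly_shift)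
  then have "f mod monom 1 s = poly_cutoff s f mod monom 1 s"
    by (metis mod_mult_self3)
  also have "degree (poly_cutoff s f) \<le> s - 1"
    by (rule degree_le) (auto simp: coeff_poly_cutoff)
  then have "poly_cutoff s f mod monom 1 s = poly_cutoff s f"
    using False by (intro mod_poly_less) (simp add: degree_monom_eq)
  finally show ?thesis by (simp add: ptruncate_def)
qed

lemma monom_mod_monom_minus_1:
  fixes c :: "'a :: field"
  assumes "m > 0"
  shows "monom c n mod (monom 1 m - 1) = monom c (n mod m)"
proof -
  have "monom c (l * m + k) mod (monom 1 m - 1) = monom c k mod (monom 1 m - 1)" for l k
  proof (induction l)
    case (Suc l)
    have "monom c (Suc l * m + k)
        = monom c (l * m + k) * (monom 1 m - 1) + monom c (l * m + k)"
      by (simp add: algebra_simps mult_monom)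
    then show ?case using Suc by (metis mod_mult_self3)
  qed simp
  from this[of "n div m" "n mod m"]
  have "monom c n mod (monom 1 m - 1) = monom c (n mod m) mod (monom 1 m - 1)" by simp
  also have "\<dots> = monom c (n mod m)"
  proof (rule mod_poly_less)
    have "degree (monom c (n mod m)) \<le> n mod m" by (rule degree_monom_le)
    also have "\<dots> < m" using assms by simp
    finally show "degree (monom c (n mod m)) < degree (monom 1 m - 1 :: 'a poly)"
      using assms by (simp add: degree_monom_minus_1)
  qed
  finally show ?thesis .
qed

lemma poly_mod_sum:
  fixes f :: "'b \<Rightarrow> 'a :: field poly"
  shows "(\<Sum>x\<in>A. f x) mod q = (\<Sum>x\<in>A. f x mod q)"
  by (induction A rule: infinite_finite_induct) (auto simp: poly_mod_add_left)

lemma degree_protate_less: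
  assumes "m > 0"
  shows "degree (protate m s f) < m"
proof -
  have "monom 1 m - 1 \<noteq> (0 :: complex poly)"
    using degree_monom_minus_1[OF assms, where ?'a = complex] assms by auto
  then show ?thesis
    using degree_mod_less[of "monom 1 m - 1" "monom 1 (m - nat (s mod int m)) * f"] assms
    by (auto simp: protate_def degree_monom_minus_1)
qed

text \<open>The product of the \<open>s\<close>-th coefficient of \<open>f\<close> and the
  \<open>t\<close>-th of \<open>g\<close> lands at the exponent \<open>e + t + s * r\<close> mod
  \<open>m\<close>. For given \<open>s\<close> and \<open>k\<close>, exactly one
  \<open>t < m\<close> hits \<open>k\<close>.\<close>

lemma coeff_protate_mult_pexpand_ptruncate:
  assumes k: "k < m" and deg: "degree g < m"
  shows "coeff (protate m (int (i * (p mod m)))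
      (g * pexpand m (int (p mod m)) (ptruncate (i + 1) f))) k
    = (\<Sum>s\<le>i. coeff f s * coeff g (((i - s) * p + k) mod m))"
proof -
  define r where "r = p mod m"
  \<comment> \<open>Represents \<open>- i * r\<close> mod \<open>m\<close>; the value is
    \<open>m\<close> rather than 0 when \<open>m\<close> divides \<open>i * r\<close>, which the
    reduction by x^m - 1 absorbs.\<close>
  define e where "e = m - i * r mod m"
  have m: "m > 0" using k by simp
  have "pexpand m (int r) (ptruncate (i + 1) f)
      = (\<Sum>s\<le>i. monom (coeff (ptruncate (i + 1) f) s) (s * r))"
    unfolding pexpand_def r_def zmod_int[symmetric] nat_int mod_mod_trivial
    by (rule pcompose_monom_eq_sum, rule degree_le) (simp add: ptruncate_eq_poly_cutoff coeff_poly_cutoff)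
  also have "\<dots> = (\<Sum>s\<le>i. monom (coeff f s) (s * r))"
    by (intro sum.cong) (auto simp: ptruncate_eq_poly_cutoff coeff_poly_cutoff)
  finally have E: "pexpand m (int r) (ptruncate (i + 1) f) = (\<Sum>s\<le>i. monom (coeff f s) (s * r))" .
  have g: "g = (\<Sum>t<m. monom (coeff g t) t)"
    using deg by (intro poly_eqI) (auto simp: coeff_sum coeff_eq_0)
  have "monom 1 e * (g * pexpand m (int r) (ptruncate (i + 1) f))
      = (\<Sum>s\<le>i. \<Sum>t<m. monom (coeff f s * coeff g t) (e + t + s * r))"
    unfolding E
    by (subst g) (simp add: sum_distrib_left sum_distrib_right mult_monom ac_simps sum.swap[of _ "{..i}"])
  then have "protate m (int (i * r)) (g * pexpand m (int r) (ptruncate (i + 1) f))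
      = (\<Sum>s\<le>i. \<Sum>t<m. monom (coeff f s * coeff g t) ((e + t + s * r) mod m))"
    unfolding protate_def zmod_int[symmetric] nat_int e_def
    by (simp only: poly_mod_sum monom_mod_monom_minus_1[OF m])
  then have "coeff (protate m (int (i * r)) (g * pexpand m (int r) (ptruncate (i + 1) f))) k
      = (\<Sum>s\<le>i. \<Sum>t<m. if (e + t + s * r) mod m = k then coeff f s * coeff g t else 0)"
    by (simp add: coeff_sum)
  also have "\<dots> = (\<Sum>s\<le>i. coeff f s * coeff g (((i - s) * p + k) mod m))"
  proof (rule sum.cong[OF refl])
    fix s assume s: "s \<in> {..i}"
    have "[s * r + (i - s) * p = s * r + (i - s) * r] (mod m)"
      by (intro cong_add cong_mult cong_refl) (simp add: r_def cong_def)
    also have "s * r + (i - s) * r = i * r"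
      using s by (simp flip: add_mult_distrib)
    finally have "[e + (s * r + (i - s) * p) = e + i * r] (mod m)"
      by (intro cong_add cong_refl)
    also have "[e + i * r = e + i * r mod m] (mod m)"
      by (intro cong_add cong_refl) (simp add: cong_def)
    also have "e + i * r mod m = m"
      using m by (simp add: e_def)
    also have "[m = 0] (mod m)" by (simp add: cong_def)
    finally have z: "[e + (s * r + (i - s) * p) = 0] (mod m)" .
    \<comment> \<open>Adding \<open>(i - s) * p\<close> to both sides cancels
      \<open>e + s * r\<close> by \<open>z\<close>, so no subtraction of naturals beyond
      \<open>i - s\<close> arises.\<close>
    have "(e + t + s * r) mod m = k \<longleftrightarrow> t = ((i - s) * p + k) mod m" if t: "t < m" for t
    proof -
      have "(e + t + s * r) mod m = k \<longleftrightarrow> [e + t + s * r = k] (mod m)"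
        using k by (simp add: cong_def)
      also have "\<dots> \<longleftrightarrow> [e + t + s * r + (i - s) * p = k + (i - s) * p] (mod m)"
        by (rule cong_add_rcancel_nat[symmetric])
      also have "e + t + s * r + (i - s) * p = (e + (s * r + (i - s) * p)) + t" by simp
      also have "[(e + (s * r + (i - s) * p)) + t = k + (i - s) * p] (mod m)
          \<longleftrightarrow> [t = k + (i - s) * p] (mod m)"
        using cong_add[OF z cong_refl[of t m]] by (metis add_0 cong_sym cong_trans)
      also have "\<dots> \<longleftrightarrow> t = ((i - s) * p + k) mod m"
        using t by (simp add: cong_def add.commute)
      finally show ?thesis .
    qed
    then have "(\<Sum>t<m. if (e + t + s * r) mod m = k then coeff f s * coeff g t else 0)
        = (\<Sum>t<m. if t = ((i - s) * p + k) mod m then coeff f s * coeff g t else 0)"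
      by (intro sum.cong) auto
    also have "\<dots> = coeff f s * coeff g (((i - s) * p + k) mod m)"
      using m by simp
    finally show "(\<Sum>t<m. if (e + t + s * r) mod m = k then coeff f s * coeff g t else 0)
        = coeff f s * coeff g (((i - s) * p + k) mod m)" .
  qed
  finally show ?thesis by (simp add: r_def)
qed

section \<open>Coefficients of the subblocks and the comparison\<close>

text \<open>The shift by \<open>j * m\<close> disappears mod \<open>m\<close>, so \<open>j\<close>
  enters only through the guard \<open>j * m + k < p\<close>, which marks the end of the
  \<open>i\<close>-th block.\<close>

lemma coeff_cyc_subblock:
  assumes m: "m > 0" and p: "prime p" and cop: "coprime p m"
  shows "coeff (cyc_subblock m p i j) k = (if k < m \<and> j * m + k < p
    then - (\<Sum>s\<le>i. coeff (cyclotomic m) s * coeff (inv_cyclotomic m) (((i - s) * p + k) mod m))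
    else 0)"
proof -
  have p0: "p > 0" using p by (rule prime_gt_0_nat)
  have blk: "coeff (blocks n f l) t = (if t < n then coeff f (l * n + t) else 0)" if "n > 0" for n f l t
    using is_blocks_coeff is_blocks_iff[OF that] by blast
  have "coeff (cyc_subblock m p i j) k
      = (if k < m \<and> j * m + k < p then coeff (cyclotomic (m * p)) (i * p + (j * m + k)) else 0)"
    by (simp add: cyc_subblock_def cyc_block_def blk m p0)
  moreover have "coeff (cyclotomic (m * p)) (i * p + (j * m + k))
    = - (\<Sum>s\<le>i. coeff (cyclotomic m) s * coeff (inv_cyclotomic m) (((i - s) * p + k) mod m))"
    if less: "j * m + k < p"
  proof -
    have "(i * p + (j * m + k)) div p = i" using less p0 by simp
    moreover have "(i * p + (j * m + k) - s * p) mod m = ((i - s) * p + k) mod m" if "s \<le> i" for s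
    proof -
      have "i * p + (j * m + k) - s * p = (i - s) * p + k + j * m"
        using mult_le_mono1[OF that, of p] unfolding diff_mult_distrib by linarith
      then show ?thesis by simp
    qed
    ultimately show ?thesis by (simp add: coeff_cyclotomic_mult_prime[OF assms])
  qed
  ultimately show ?thesis by simp
qed

theorem mainTheorem1:
  fixes m p r q i j :: nat
  assumes "m > 0" and "odd m" and "squarefree m"
    and "prime p" and "coprime p m"
    and "r = p mod m" and "q = p div m"
    and "i \<le> totient m - 1" and "j \<le> q"
  shows "cyc_subblock m p i j =
    (if j < q
     then - protate m (int (i * r))
              (inv_cyclotomic m * pexpand m (int r) (ptruncate (i + 1) (cyclotomic m)))
     else ptruncate r (cyc_subblock m p i 0))"
proof (rule poly_eqI)
  fix k
  note sub = coeff_cyc_subblock[OF assms(1,4,5)]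
  have pqr: "p = q * m + r" using assms(6,7) by simp
  have rm: "r < m" using assms(1,6) by simp
  let ?R = "protate m (int (i * r))
    (inv_cyclotomic m * pexpand m (int r) (ptruncate (i + 1) (cyclotomic m)))"
  show "coeff (cyc_subblock m p i j) k
    = coeff (if j < q then - ?R else ptruncate r (cyc_subblock m p i 0)) k"
  proof (cases "j < q")
    case j: True
    show ?thesis
    proof (cases "k < m")
      case True
      \<comment> \<open>A subblock with \<open>j < q\<close> lies wholly inside its block, so the
        guard holds for all \<open>k < m\<close>.\<close>
      have "Suc j * m \<le> q * m" using j by (intro mult_le_mono1) simp
      then have "j * m + k < p" using True pqr by simp
      then show ?thesis
        using True j
          coeff_protate_mult_pexpand_ptruncate[OF True degree_inv_cyclotomic_less[OF assms(1)]]
        by (simp add: sub assms(6))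
    next
      case False
      then have "coeff ?R k = 0"
        using degree_protate_less[OF assms(1)] by (intro coeff_eq_0) (meson less_le_trans not_less)
      then show ?thesis using False j by (simp add: sub)
    qed
  next
    case False
    then have "j = q" using assms(9) by simp
    \<comment> \<open>In the last subblock the guard cuts off at \<open>r\<close>; below
      \<open>r\<close> the guard for subblock 0 holds as well, so both have the same coefficients
      there.\<close>
    moreover have "q * m + k < p \<longleftrightarrow> k < r" "k < r \<Longrightarrow> k < p" using pqr by auto
    ultimately show ?thesis
      using rm by (auto simp: sub ptruncate_eq_poly_cutoff coeff_poly_cutoff)
  qed
qed

end
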